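(* Let $x=P(x)$ be a PPS in simple normal form with LFP $q^*$ satisfying $\mathbf{0} < q^* < \mathbf{1}$, and let $j\ge 0$ be an integer. If the rounded down Newton's method with rounding parameter $h = j + 2 + 4|P|$ is applied to $x=P(x)$, then all iterates $x^{[k]}$ are well defined, $\mathbf{0} \leq x^{[k]} \leq q^*$ for every $k \geq 0$, and $$\| q^* - x^{[j+2+4|P|]} \|_{\infty} \leq 2^{-j}.$$
   Context: A PPS is a system $x_i = P_i(x)$, $i=1,\dots,n$, where each $P_i$ is a polynomial with nonnegative rational coefficients (including constant term) summing to at most $1$; its LFP $q^*\in[0,1]^n$ is the coordinatewise least nonnegative solution. It is in simple normal form if each $P_i$ is either $x_jx_k$ or a linear expression $\sum_{j} p_{i,j}x_j + p_{i,0}$ (nonnegative coefficients summing to at most 1). $|P|$ is $n$ plus the total number of bits of all nonzero coefficients (binary numerator/denominator) and nonzero exponents. $B(x)$ is the Jacobian of $P$ and $\mathcal{N}_P(z) := z + (I-B(z))^{-1}(P(z)-z)$. Rounded down Newton's method with integer rounding parameter $h>0$: $x^{[0]} := \mathbf{0}$; given $x^{[k]}$, compute $x^{\{k+1\}} := \mathcal{N}_P(x^{[k]})$, and for each coordinate $i$ set $x^{[k+1]}_i$ to be the largest nonnegative integer multiple of $2^{-h}$ that is $\le \max(x^{\{k+1\}}_i, 0)$. *)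

theory Defs
  imports "HOL-Analysis.Analysis" "HOL-Library.Poly_Mapping" "HOL-Library.Log_Nat"
begin

(* The variables x_1, ..., x_n are indexed by a finite type 'n, n = CARD('n).  A monomial is its
   finitely supported exponent vector, a polynomial its finitely supported coefficient function. *)

type_synonym 'n mon = "'n \<Rightarrow>\<^sub>0 nat"
type_synonym 'n qpoly = "'n mon \<Rightarrow>\<^sub>0 rat"
type_synonym 'n system = "'n \<Rightarrow> 'n qpoly"

definition poly_eval :: "'n::finite qpoly \<Rightarrow> real ^ 'n \<Rightarrow> real" where
  "poly_eval p x =
     (\<Sum>m\<in>Poly_Mapping.keys p. of_rat (Poly_Mapping.lookup p m) *
        (\<Prod>i\<in>UNIV. (x $ i) ^ Poly_Mapping.lookup m i))"

definition system_eval :: "'n::finite system \<Rightarrow> real ^ 'n \<Rightarrow> real ^ 'n" where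
  "system_eval P x = (\<chi> i. poly_eval (P i) x)"

definition is_PPS :: "'n::finite system \<Rightarrow> bool" where
  "is_PPS P \<longleftrightarrow>
     (\<forall>i. (\<forall>m. 0 \<le> Poly_Mapping.lookup (P i) m) \<and>
          (\<Sum>m\<in>Poly_Mapping.keys (P i). Poly_Mapping.lookup (P i) m) \<le> 1)"

(* The order on real ^ 'n is coordinatewise. *)
definition is_LFP :: "'n::finite system \<Rightarrow> real ^ 'n \<Rightarrow> bool" where
  "is_LFP P q \<longleftrightarrow>
     0 \<le> q \<and> q = system_eval P q \<and> (\<forall>x. 0 \<le> x \<longrightarrow> x = system_eval P x \<longrightarrow> q \<le> x)"

definition is_product_form :: "'n::finite qpoly \<Rightarrow> bool" where
  "is_product_form p \<longleftrightarrow>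
     (\<exists>j k. p = Poly_Mapping.single (Poly_Mapping.single j 1 + Poly_Mapping.single k 1) 1)"

(* Every monomial is constant or a single variable; for a PPS the conditions on the coefficients
   of a linear expression are part of is_PPS. *)
definition is_linear_form :: "'n::finite qpoly \<Rightarrow> bool" where
  "is_linear_form p \<longleftrightarrow>
     (\<forall>m\<in>Poly_Mapping.keys p. m = 0 \<or> (\<exists>j. m = Poly_Mapping.single j 1))"

definition is_simple_normal_form :: "'n::finite system \<Rightarrow> bool" where
  "is_simple_normal_form P \<longleftrightarrow> (\<forall>i. is_product_form (P i) \<or> is_linear_form (P i))"

(* floorlog 2 a is the length of the binary representation of a > 0; quotient_of gives the
   fraction in lowest terms with positive denominator. *)
definition rat_bits :: "rat \<Rightarrow> nat" where
  "rat_bits r = (case quotient_of r of (a, b) \<Rightarrow> floorlog 2 (nat \<bar>a\<bar>) + floorlog 2 (nat b))"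

(* keys ranges over exactly the nonzero coefficients, respectively the nonzero exponents. *)
definition system_size :: "'n::finite system \<Rightarrow> nat" where
  "system_size P = CARD('n) +
     (\<Sum>i\<in>UNIV. \<Sum>m\<in>Poly_Mapping.keys (P i).
        rat_bits (Poly_Mapping.lookup (P i) m) +
        (\<Sum>j\<in>Poly_Mapping.keys m. floorlog 2 (Poly_Mapping.lookup m j)))"

definition Jac :: "'n::finite system \<Rightarrow> real ^ 'n \<Rightarrow> real ^ 'n ^ 'n" where
  "Jac P x = jacobian (system_eval P) (at x)"

(* Meaningful only if mat 1 - Jac P z is invertible; matrix_inv is unspecified otherwise. *)
definition newton_op :: "'n::finite system \<Rightarrow> real ^ 'n \<Rightarrow> real ^ 'n" where
  "newton_op P z = z + matrix_inv (mat 1 - Jac P z) *v (system_eval P z - z)"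

definition round_down :: "nat \<Rightarrow> real \<Rightarrow> real" where
  "round_down h y = (GREATEST r. (\<exists>m::nat. r = real m * (1 / 2 ^ h)) \<and> r \<le> max y 0)"

lemma round_down_eq: "round_down h y = real (nat \<lfloor>2 ^ h * max y 0\<rfloor>) * (1 / 2 ^ h)"
  unfolding round_down_def
proof (rule Greatest_equality)
  have "real (nat \<lfloor>2 ^ h * max y 0\<rfloor>) \<le> 2 ^ h * max y 0"
    by (rule of_nat_floor) simp
  then show "(\<exists>m::nat. real (nat \<lfloor>2 ^ h * max y 0\<rfloor>) * (1 / 2 ^ h) = real m * (1 / 2 ^ h)) \<and>
      real (nat \<lfloor>2 ^ h * max y 0\<rfloor>) * (1 / 2 ^ h) \<le> max y 0"
    by (intro conjI exI[of _ "nat \<lfloor>2 ^ h * max y 0\<rfloor>"] refl)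
      (simp add: pos_divide_le_eq mult.commute del: of_nat_nat)
next
  fix r :: real
  assume "(\<exists>m::nat. r = real m * (1 / 2 ^ h)) \<and> r \<le> max y 0"
  then obtain m :: nat where m: "r = real m * (1 / 2 ^ h)" "r \<le> max y 0" by blast
  then have "real m \<le> 2 ^ h * max y 0" by (simp add: pos_divide_le_eq mult.commute)
  then have "m \<le> nat \<lfloor>2 ^ h * max y 0\<rfloor>" by (rule le_nat_floor)
  then show "r \<le> real (nat \<lfloor>2 ^ h * max y 0\<rfloor>) * (1 / 2 ^ h)"
    unfolding m(1) by (intro mult_right_mono of_nat_mono) simp_all
qed

primrec rounded_newton :: "'n::finite system \<Rightarrow> nat \<Rightarrow> nat \<Rightarrow> real ^ 'n" where
  "rounded_newton P h 0 = 0"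
| "rounded_newton P h (Suc k) =
     (\<chi> i. round_down h (newton_op P (rounded_newton P h k) $ i))"

(* No step of the iteration ever applies the Newton operator at a point where it is undefined. *)
definition rounded_newton_well_defined :: "'n::finite system \<Rightarrow> nat \<Rightarrow> bool" where
  "rounded_newton_well_defined P h \<longleftrightarrow>
     (\<forall>k. invertible (mat 1 - Jac P (rounded_newton P h k)))"

end

theory Submission
  imports Defs
begin

text \<open>
  Put \<open>v = 1 - q\<close>. For \<open>0 \<le> x \<le> q\<close> the matrix \<open>I - B(x)\<close> is a nonsingular M-matrix,
  because \<open>B(x) v \<le> v\<close> and equality on a closed set of rows would contradict the minimality of
  \<open>q\<close>. Hence a Newton step stays below \<open>q\<close>, and it improves \<open>q - x \<le> t v\<close> to
  \<open>q - N(x) \<le> (t / 2) v\<close>; rounding adds at most \<open>2 ^ - h \<le> (2 ^ - h / min v) v\<close>.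

  It remains to see that every entry of \<open>v\<close> is at least \<open>2 ^ - (4 |P|)\<close>. A suitable multiple
  of \<open>v\<close> satisfies the integer inequalities \<open>u i \<ge> 1\<close>, \<open>u (l i) + u (r i) - u i \<ge> 1\<close> for
  the product rows \<open>i\<close>, and \<open>(\<Sum>j. a i j * u j) \<ge> u i\<close>, after clearing denominators, for
  the linear rows whose coefficients sum to 1. By Cramer's rule a vertex of this polyhedron has
  entries at most \<open>2 ^ (2 |P|)\<close>. A small multiple \<open>w\<close> of the vertex makes \<open>1 - w\<close> a
  prefixed point, so \<open>q \<le> 1 - w\<close>.
\<close>

section \<open>Small solutions of integer linear inequalities\<close>

lemma det_in_Ints:
  fixes A :: "real ^ 'n ^ 'n"
  assumes "\<And>i j. A $ i $ j \<in> \<int>"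
  shows "det A \<in> \<int>"
  unfolding det_def by (intro Ints_sum Ints_mult Ints_of_int Ints_prod assms)

text \<open>In the Leibniz expansion the sum over permutations is enlarged to a sum over all
  self-maps of the index set; by distributivity the latter factors into row sums.\<close>

lemma abs_det_le_prod_row_sums:
  fixes A :: "real ^ 'n ^ 'n"
  shows "\<bar>det A\<bar> \<le> (\<Prod>i\<in>UNIV. \<Sum>j\<in>UNIV. \<bar>A $ i $ j\<bar>)"
proof -
  have "\<bar>det A\<bar> \<le> (\<Sum>p | p permutes UNIV. \<bar>of_int (sign p) * (\<Prod>i\<in>UNIV. A $ i $ p i)\<bar>)"
    unfolding det_def by (rule sum_abs)
  also have "\<dots> = (\<Sum>p | p permutes UNIV. \<Prod>i\<in>UNIV. \<bar>A $ i $ p i\<bar>)"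
    by (intro sum.cong refl) (simp add: abs_mult abs_prod sign_def)
  also have "\<dots> \<le> (\<Sum>p\<in>UNIV. \<Prod>i\<in>UNIV. \<bar>A $ i $ p i\<bar>)"
    by (intro sum_mono2) (auto intro: prod_nonneg)
  also have "\<dots> = (\<Prod>i\<in>UNIV. \<Sum>j\<in>UNIV. \<bar>A $ i $ j\<bar>)"
    using prod_sum_PiE[of UNIV "\<lambda>_. UNIV" "\<lambda>i j. \<bar>A $ i $ j\<bar>"] by (simp add: PiE_UNIV_domain)
  finally show ?thesis .
qed

text \<open>Cramer's rule: a nonzero integer determinant is at least 1 in absolute value, so only
  the numerator counts. Putting \<open>b\<close> into column \<open>k\<close> raises the sum of row
  \<open>i\<close> by at most \<open>\<bar>b $ i\<bar>\<close>.\<close>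

lemma integer_system_solution_bound:
  fixes A :: "real ^ 'n ^ 'n"
  assumes int: "\<And>i j. A $ i $ j \<in> \<int>" and nz: "det A \<noteq> 0" and sol: "A *v x = b"
  shows "\<bar>x $ k\<bar> \<le> (\<Prod>i\<in>UNIV. (\<Sum>j\<in>UNIV. \<bar>A $ i $ j\<bar>) + \<bar>b $ i\<bar>)"
proof -
  let ?C = "\<chi> i j. if j = k then b $ i else A $ i $ j"
  have x: "x = (\<chi> k. det (\<chi> i j. if j = k then b $ i else A $ i $ j) / det A)"
    using cramer[OF nz] sol by blast
  have "x $ k = det ?C / det A"
    by (subst x) simp
  moreover have "1 \<le> \<bar>det A\<bar>"
    using det_in_Ints[OF int] nz by (rule Ints_nonzero_abs_ge1)
  ultimately have "\<bar>x $ k\<bar> \<le> \<bar>det ?C\<bar>"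
    by (simp add: abs_divide divide_le_eq mult_le_cancel_left1)
  also have "\<dots> \<le> (\<Prod>i\<in>UNIV. \<Sum>j\<in>UNIV. \<bar>?C $ i $ j\<bar>)"
    by (rule abs_det_le_prod_row_sums)
  also have "\<dots> \<le> (\<Prod>i\<in>UNIV. (\<Sum>j\<in>UNIV. \<bar>A $ i $ j\<bar>) + \<bar>b $ i\<bar>)"
  proof (intro prod_mono conjI sum_nonneg abs_ge_zero)
    fix i
    have "(\<Sum>j\<in>UNIV. \<bar>?C $ i $ j\<bar>) \<le> (\<Sum>j\<in>UNIV. \<bar>A $ i $ j\<bar> + (if j = k then \<bar>b $ i\<bar> else 0))"
      by (intro sum_mono) auto
    then show "(\<Sum>j\<in>UNIV. \<bar>?C $ i $ j\<bar>) \<le> (\<Sum>j\<in>UNIV. \<bar>A $ i $ j\<bar>) + \<bar>b $ i\<bar>"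
      by (simp add: sum.distrib)
  qed
  finally show ?thesis .
qed

text \<open>A feasible point with the largest number of tight constraints is a vertex: along a direction
  orthogonal to all tight constraints one could move until another constraint becomes tight.\<close>

lemma exists_vertex:
  fixes a :: "'c::finite \<Rightarrow> 'a::euclidean_space" and b :: "'c \<Rightarrow> real"
  assumes feasible: "\<And>c. b c \<le> a c \<bullet> x0"
    and pointed: "\<And>y. (\<And>c. a c \<bullet> y = 0) \<Longrightarrow> y = 0"
  shows "\<exists>x. (\<forall>c. b c \<le> a c \<bullet> x) \<and> span (a ` {c. a c \<bullet> x = b c}) = UNIV"
proof -
  let ?F = "\<lambda>x. \<forall>c. b c \<le> a c \<bullet> x"
  let ?T = "\<lambda>x. {c. a c \<bullet> x = b c}"
  define x where "x = (ARG_MAX (card \<circ> ?T) x. ?F x)"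
  have "?F x0" using feasible by simp
  moreover have "\<forall>y. ?F y \<longrightarrow> (card \<circ> ?T) y < Suc CARD('c)"
    by (auto simp: less_Suc_eq_le intro: card_mono)
  ultimately have "?F x \<and> (\<forall>y. ?F y \<longrightarrow> (card \<circ> ?T) y \<le> (card \<circ> ?T) x)"
    unfolding x_def by (rule arg_max_nat_lemma)
  then have F: "?F x" and max: "\<And>y. ?F y \<Longrightarrow> card (?T y) \<le> card (?T x)"
    by auto
  have "span (a ` ?T x) = UNIV"
  proof (rule ccontr)
    assume "span (a ` ?T x) \<noteq> UNIV"
    then obtain z where z: "z \<noteq> 0" "span (a ` ?T x) \<subseteq> {w. z \<bullet> w = 0}"
      using span_not_univ_subset_hyperplane by blast
    from z(2) have zT: "a c \<bullet> z = 0" if "c \<in> ?T x" for c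
      using span_base[of "a c" "a ` ?T x"] that by (auto simp: inner_commute)
    obtain c0 where c0: "a c0 \<bullet> z \<noteq> 0" using pointed z(1) by blast
    \<comment> \<open>The sign makes at least one constraint decrease along \<open>y\<close>, so
      that the set \<open>N\<close> below is nonempty.\<close>
    define y where "y = (if a c0 \<bullet> z < 0 then z else - z)"
    have yneg: "a c0 \<bullet> y < 0" using c0 by (auto simp: y_def)
    have yT: "a c \<bullet> y = 0" if "c \<in> ?T x" for c using zT[OF that] by (simp add: y_def)
    define N where "N = {c. a c \<bullet> y < 0}"
    \<comment> \<open>\<open>ratio c\<close> is the step length at which the decreasing constraint
      \<open>c\<close> becomes tight; the minimum \<open>t\<close> is the longest step that stays
      feasible.\<close>
    define ratio where "ratio c = (a c \<bullet> x - b c) / (- (a c \<bullet> y))" for c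
    define t where "t = Min (ratio ` N)"
    have "N \<noteq> {}" "finite N" using yneg by (auto simp: N_def)
    then have "t \<in> ratio ` N" and t_le: "\<And>c. c \<in> N \<Longrightarrow> t \<le> ratio c"
      unfolding t_def by auto
    then obtain c1 where c1: "c1 \<in> N" "t = ratio c1" by blast
    have t0: "0 \<le> t" using F c1 by (auto simp: N_def ratio_def intro!: divide_nonneg_neg)
    have "?F (x + t *\<^sub>R y)"
    proof
      fix c
      show "b c \<le> a c \<bullet> (x + t *\<^sub>R y)"
      proof (cases "c \<in> N")
        case True
        from t_le[OF this] True have "t * (- (a c \<bullet> y)) \<le> a c \<bullet> x - b c"
          unfolding ratio_def N_def by (subst (asm) pos_le_divide_eq) auto
        then show ?thesis by (simp add: inner_add_right)
      next
        case False
        then show ?thesis using F t0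
          by (auto simp: N_def inner_add_right intro: add_increasing2)
      qed
    qed
    then have "card (?T (x + t *\<^sub>R y)) \<le> card (?T x)" by (rule max)
    moreover have "?T x \<subset> ?T (x + t *\<^sub>R y)"
    proof
      show "?T x \<subseteq> ?T (x + t *\<^sub>R y)" using yT by (auto simp: inner_add_right)
      have "c1 \<notin> ?T x" using c1(1) yT[of c1] by (auto simp: N_def)
      moreover have "c1 \<in> ?T (x + t *\<^sub>R y)"
        using c1 by (auto simp: N_def ratio_def inner_add_right field_simps)
      ultimately show "?T x \<noteq> ?T (x + t *\<^sub>R y)" by blast
    qed
    then have "card (?T x) < card (?T (x + t *\<^sub>R y))"
      by (intro psubset_card_mono) auto
    ultimately show False by simp
  qed
  with F show ?thesis by blast
qed

text \<open>The tight rows at a vertex span the space, so as many independent ones as there are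
  variables form a nonsingular integer system that determines the vertex. The bound
  \<open>1 \<le> w c\<close> allows the product over these rows to be extended to all
  constraints.\<close>

lemma bounded_solution_of_integer_inequalities:
  fixes a :: "'c::finite \<Rightarrow> real ^ 'n" and b w :: "'c \<Rightarrow> real"
  assumes int: "\<And>c j. a c $ j \<in> \<int>"
    and feasible: "\<And>c. b c \<le> a c \<bullet> x0"
    and pointed: "\<And>y. (\<And>c. a c \<bullet> y = 0) \<Longrightarrow> y = 0"
    and w: "\<And>c. 1 \<le> w c" "\<And>c. (\<Sum>j\<in>UNIV. \<bar>a c $ j\<bar>) + \<bar>b c\<bar> \<le> w c"
  shows "\<exists>x. (\<forall>c. b c \<le> a c \<bullet> x) \<and> (\<forall>k. \<bar>x $ k\<bar> \<le> (\<Prod>c\<in>UNIV. w c))"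
proof -
  have "\<exists>x. (\<forall>c. b c \<le> a c \<bullet> x) \<and> span (a ` {c. a c \<bullet> x = b c}) = UNIV"
  proof (rule exists_vertex)
    show "b c \<le> a c \<bullet> x0" for c by (rule feasible)
    show "y = 0" if "\<And>c. a c \<bullet> y = 0" for y using that by (rule pointed)
  qed
  then obtain x where F: "\<And>c. b c \<le> a c \<bullet> x"
    and sp: "span (a ` {c. a c \<bullet> x = b c}) = UNIV"
    by blast
  define T where "T = {c. a c \<bullet> x = b c}"
  obtain B where B: "B \<subseteq> a ` T" "independent B" "a ` T \<subseteq> span B"
    by (rule maximal_independent_subset)
  have "span B = UNIV"
    using span_minimal[OF B(3) subspace_span] sp by (auto simp: T_def)
  then have "card B = CARD('n)"
    using dim_eq_card_independent[OF B(2)] dim_span[of B] by (simp add: dim_UNIV)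
  then obtain f where f: "bij_betw f (UNIV :: 'n set) B"
    using finite_same_card_bij[of "UNIV :: 'n set" B] independent_imp_finite[OF B(2)] by auto
  then have fB: "range f = B" and injf: "inj f"
    by (auto simp: bij_betw_def)
  have "\<exists>c. c \<in> T \<and> a c = f i" for i
    using fB B(1) by (metis imageE rangeI subsetD)
  \<comment> \<open>\<open>r\<close> picks for each basis vector one tight constraint having it as
    normal; distinct vectors give distinct constraints.\<close>
  then obtain r where r: "\<And>i. r i \<in> T" "\<And>i. a (r i) = f i" by metis
  have "inj r" using injf r(2) by (metis injD injI)
  let ?A = "\<chi> i. a (r i)"
  have "y = 0" if "?A *v y = 0" for y
  proof -
    have "B \<subseteq> {z. y \<bullet> z = 0}"
    proof
      fix z assume "z \<in> B"
      then obtain i where "z = f i" using fB by blast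
      then have "z \<bullet> y = (?A *v y) $ i" by (simp add: matrix_vector_mul_component r(2))
      with that show "z \<in> {z. y \<bullet> z = 0}" by (simp add: inner_commute)
    qed
    then have "span B \<subseteq> {z. y \<bullet> z = 0}"
      by (rule span_minimal) (rule subspace_hyperplane)
    with \<open>span B = UNIV\<close> have "y \<bullet> y = 0" by blast
    then show ?thesis by simp
  qed
  then have "det ?A \<noteq> 0"
    by (simp add: invertible_det_nz[symmetric] invertible_left_inverse matrix_left_invertible_ker)
  moreover have "?A *v x = (\<chi> i. b (r i))"
    using r(1) by (simp add: vec_eq_iff matrix_vector_mul_component T_def)
  ultimately have x_k: "\<bar>x $ k\<bar> \<le> (\<Prod>i\<in>UNIV. (\<Sum>j\<in>UNIV. \<bar>?A $ i $ j\<bar>) + \<bar>(\<chi> i. b (r i)) $ i\<bar>)" for k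
    by (intro integer_system_solution_bound) (simp_all add: int)
  have "\<bar>x $ k\<bar> \<le> (\<Prod>c\<in>UNIV. w c)" for k
  proof -
    note x_k
    also have "(\<Prod>i\<in>UNIV. (\<Sum>j\<in>UNIV. \<bar>?A $ i $ j\<bar>) + \<bar>(\<chi> i. b (r i)) $ i\<bar>) \<le> (\<Prod>i\<in>UNIV. w (r i))"
      by (intro prod_mono conjI) (auto intro: w sum_nonneg add_nonneg_nonneg)
    also have "\<dots> = (\<Prod>c\<in>range r. w c)"
      using \<open>inj r\<close> by (simp add: prod.reindex)
    also have "\<dots> \<le> (\<Prod>c\<in>UNIV. w c)"
      using w(1) by (intro prod_mono2) (auto intro: order.trans[OF zero_le_one])
    finally show ?thesis .
  qed
  with F show ?thesis by blast
qed

section \<open>Quadratic systems in simple normal form\<close>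

lemma matrix_mul_matrix_inv: "invertible A \<Longrightarrow> A ** matrix_inv A = mat 1"
  unfolding invertible_def matrix_inv_def by (rule conjunct1) (rule someI_ex)

lemma sum_abs_axis: "(\<Sum>j\<in>UNIV. \<bar>(axis i 1 :: real ^ 'n) $ j\<bar>) = 1"
  by (simp add: axis_def if_distrib cong: if_cong)

lemma round_down_bounds:
  shows "0 \<le> round_down h y" and "round_down h y \<le> max y 0" and "y - 1 / 2 ^ h \<le> round_down h y"
proof -
  show "0 \<le> round_down h y" by (simp add: round_down_eq)
  have "real (nat \<lfloor>2 ^ h * max y 0\<rfloor>) \<le> 2 ^ h * max y 0"
    by (rule of_nat_floor) simp
  then show "round_down h y \<le> max y 0"
    by (simp add: round_down_eq pos_divide_le_eq mult.commute del: of_nat_nat)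
  have "2 ^ h * y \<le> 2 ^ h * max y 0" by simp
  also have "\<dots> \<le> real (nat \<lfloor>2 ^ h * max y 0\<rfloor>) + 1" by linarith
  finally have "y \<le> (real (nat \<lfloor>2 ^ h * max y 0\<rfloor>) + 1) / 2 ^ h"
    by (simp add: pos_le_divide_eq mult.commute del: of_nat_nat)
  then show "y - 1 / 2 ^ h \<le> round_down h y"
    by (simp add: round_down_eq add_divide_distrib del: of_nat_nat)
qed

text \<open>A system in simple normal form without the polynomial encoding. The values of
  \<open>l\<close>, \<open>r\<close> on linear rows and of \<open>a\<close>, \<open>c\<close> on
  product rows are arbitrary.\<close>

locale snf_system =
  fixes quad :: "'n::finite \<Rightarrow> bool" and l r :: "'n \<Rightarrow> 'n"
    and a :: "'n \<Rightarrow> 'n \<Rightarrow> real" and c :: "'n \<Rightarrow> real"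
  assumes a_nonneg: "\<And>i j. \<not> quad i \<Longrightarrow> 0 \<le> a i j"
    and c_nonneg: "\<And>i. \<not> quad i \<Longrightarrow> 0 \<le> c i"
    and ac_le_1: "\<And>i. \<not> quad i \<Longrightarrow> c i + (\<Sum>j\<in>UNIV. a i j) \<le> 1"
begin

definition F :: "real ^ 'n \<Rightarrow> real ^ 'n" where
  "F x = (\<chi> i. if quad i then x $ l i * x $ r i else c i + (\<Sum>j\<in>UNIV. a i j * x $ j))"

text \<open>\<open>D x y\<close> is \<open>B(x) y\<close>, the derivative of \<open>F\<close> at
  \<open>x\<close> in direction \<open>y\<close>.\<close>

definition D :: "real ^ 'n \<Rightarrow> real ^ 'n \<Rightarrow> real ^ 'n" where
  "D x y = (\<chi> i. if quad i then x $ l i * y $ r i + x $ r i * y $ l i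
                 else (\<Sum>j\<in>UNIV. a i j * y $ j))"

lemma F_quad: "quad i \<Longrightarrow> F x $ i = x $ l i * x $ r i"
  and F_linear: "\<not> quad i \<Longrightarrow> F x $ i = c i + (\<Sum>j\<in>UNIV. a i j * x $ j)"
  by (simp_all add: F_def)

lemma D_quad: "quad i \<Longrightarrow> D x y $ i = x $ l i * y $ r i + x $ r i * y $ l i"
  and D_linear: "\<not> quad i \<Longrightarrow> D x y $ i = (\<Sum>j\<in>UNIV. a i j * y $ j)"
  by (simp_all add: D_def)

lemma F_nonneg: "0 \<le> x \<Longrightarrow> 0 \<le> F x"
  by (auto simp: less_eq_vec_def F_def a_nonneg c_nonneg intro!: add_nonneg_nonneg sum_nonneg)

lemma F_mono: "0 \<le> x \<Longrightarrow> x \<le> y \<Longrightarrow> F x \<le> F y"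
  by (auto simp: less_eq_vec_def F_def a_nonneg intro!: mult_mono sum_mono intro: order.trans)

lemma D_add: "D x (y + z) = D x y + D x z"
  by (simp add: D_def vec_eq_iff algebra_simps sum.distrib)

lemma D_scaleR: "D x (t *\<^sub>R y) = t *\<^sub>R D x y"
  by (simp add: D_def vec_eq_iff algebra_simps sum_distrib_left)

lemma linear_D: "linear (D x)"
  by (rule linearI) (simp_all add: D_add D_scaleR)

lemma D_nonneg: "0 \<le> x \<Longrightarrow> 0 \<le> y \<Longrightarrow> 0 \<le> D x y"
  by (auto simp: less_eq_vec_def D_def a_nonneg intro!: add_nonneg_nonneg sum_nonneg)

text \<open>The exact Taylor expansion at \<open>x\<close>: second order terms arise only in product
  rows.\<close>

lemma F_diff:
  "(F y - F x) $ i = D x (y - x) $ i + (if quad i then (y - x) $ l i * (y - x) $ r i else 0)"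
  by (simp add: F_def D_def algebra_simps sum_subtractf)

lemma has_derivative_F: "(F has_derivative D x) (at x)"
proof (subst has_derivative_componentwise_within, intro ballI)
  have nth: "((\<lambda>x :: real ^ 'n. x $ i) has_derivative (\<lambda>y. y $ i)) (at x)" for i
    by (rule bounded_linear_imp_has_derivative[OF bounded_linear_vec_nth])
  fix e :: "real ^ 'n" assume "e \<in> Basis"
  then obtain i where e: "e = axis i 1" by (auto simp: Basis_vec_def)
  show "((\<lambda>x. F x \<bullet> e) has_derivative (\<lambda>y. D x y \<bullet> e)) (at x)"
  proof (cases "quad i")
    case True
    show ?thesis
      using has_derivative_mult[OF nth[of "l i"] nth[of "r i"]]
      by (simp add: e inner_axis F_quad D_quad True mult.commute)
  next
    case False
    have "((\<lambda>x. c i + (\<Sum>j\<in>UNIV. a i j * x $ j)) has_derivative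
        (\<lambda>y. 0 + (\<Sum>j\<in>UNIV. a i j * y $ j))) (at x)"
      by (intro has_derivative_add has_derivative_const has_derivative_sum
          has_derivative_mult_right nth)
    then show ?thesis by (simp add: e inner_axis F_linear D_linear False)
  qed
qed

lemma jacobian_F: "jacobian F (at x) *v y = D x y"
  unfolding jacobian_def frechet_derivative_at[OF has_derivative_F, symmetric]
  by (rule matrix_works[OF linear_D[folded linear_matrix_vector_mul_eq]])

end

section \<open>The least fixed point \<open>q\<close>, Newton steps below it, and the gap
  \<open>1 - q\<close>\<close>

locale snf_system_lfp = snf_system quad l r a c
  for quad :: "'n::finite \<Rightarrow> bool" and l r a c +
  fixes q :: "real ^ 'n"
  assumes F_q: "F q = q"
    and q_least: "\<And>x. 0 \<le> x \<Longrightarrow> F x = x \<Longrightarrow> q \<le> x"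
    and q_pos: "\<And>i. 0 < q $ i" and q_less_1: "\<And>i. q $ i < 1"
begin

abbreviation v :: "real ^ 'n" where "v \<equiv> 1 - q"

lemma v_pos: "0 < v $ i" and v_less_1: "v $ i < 1"
  using q_pos[of i] q_less_1[of i] by auto

text \<open>Knaster-Tarski: \<open>q\<close> is given as least among fixed points only, but the
  coordinatewise infimum of all nonnegative prefixed points is itself a fixed point.\<close>

lemma q_le_prefixpoint:
  assumes "0 \<le> z" "F z \<le> z"
  shows "q \<le> z"
proof -
  define S where "S = {x. 0 \<le> x \<and> F x \<le> x}"
  define m where "m = (\<chi> i. INF x\<in>S. x $ i)"
  have "z \<in> S" using assms by (simp add: S_def)
  have bdd: "bdd_below ((\<lambda>x. x $ i) ` S)" for i
    by (rule bdd_belowI[of _ 0]) (auto simp: S_def less_eq_vec_def)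
  have m_le: "m \<le> x" if "x \<in> S" for x
    using that bdd by (auto simp: m_def less_eq_vec_def intro: cINF_lower)
  have m_ge: "y \<le> m" if "\<And>x. x \<in> S \<Longrightarrow> y \<le> x" for y
    using that \<open>z \<in> S\<close> by (auto simp: m_def less_eq_vec_def intro!: cINF_greatest)
  have "0 \<le> m" by (rule m_ge) (simp add: S_def)
  have "F m \<le> m"
  proof (rule m_ge)
    fix x assume "x \<in> S"
    then have "F m \<le> F x" by (intro F_mono \<open>0 \<le> m\<close> m_le)
    with \<open>x \<in> S\<close> show "F m \<le> x" by (auto simp: S_def)
  qed
  moreover have "F m \<in> S"
    using F_nonneg[OF \<open>0 \<le> m\<close>] F_mono[OF F_nonneg[OF \<open>0 \<le> m\<close>] calculation] by (simp add: S_def)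
  ultimately have "F m = m" using m_le by (simp add: order.antisym)
  then have "q \<le> m" using \<open>0 \<le> m\<close> by (rule q_least[rotated])
  with m_le[OF \<open>z \<in> S\<close>] show ?thesis by simp
qed

lemma sum_a_v: "\<not> quad i \<Longrightarrow> (\<Sum>j\<in>UNIV. a i j * v $ j) = v $ i - (1 - c i - (\<Sum>j\<in>UNIV. a i j))"
  using F_linear[of i q] by (simp add: F_q algebra_simps sum_subtractf)

lemma v_quad: "quad i \<Longrightarrow> v $ i = v $ l i + v $ r i - v $ l i * v $ r i"
  using F_quad[of i q] by (simp add: F_q algebra_simps)

text \<open>For \<open>x \<le> q\<close> the first two terms are nonnegative and pay for the halving
  of the error in \<open>newton_step\<close>; the last is positive and makes \<open>D_v_le\<close>
  strict on product rows.\<close>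

lemma D_v_quad:
  assumes "quad i"
  shows "v $ i - D x v $ i =
    (q - x) $ l i * v $ r i + (q - x) $ r i * v $ l i + v $ l i * v $ r i"
  using F_quad[OF assms, of q] by (simp add: F_q D_quad[OF assms] algebra_simps)

lemma D_v_le:
  assumes "x \<le> q"
  shows "D x v $ i \<le> v $ i" and "quad i \<Longrightarrow> D x v $ i < v $ i"
proof -
  have quad: "D x v $ i < v $ i" if "quad i"
  proof -
    have "0 \<le> (q - x) $ l i * v $ r i + (q - x) $ r i * v $ l i"
      using assms v_pos by (intro add_nonneg_nonneg mult_nonneg_nonneg)
        (auto simp: less_eq_vec_def intro: less_imp_le)
    moreover have "0 < v $ l i * v $ r i" using v_pos by (intro mult_pos_pos)
    ultimately show ?thesis using D_v_quad[OF that, of x] by linarith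
  qed
  then show "quad i \<Longrightarrow> D x v $ i < v $ i" .
  show "D x v $ i \<le> v $ i"
  proof (cases "quad i")
    case False
    then show ?thesis using sum_a_v[of i] ac_le_1[of i] D_linear[of i x v] by linarith
  qed (use quad in simp)
qed

text \<open>If \<open>y\<close> had a negative entry, the indices minimising \<open>y i / v i\<close> would form a set \<open>C\<close> of linear
  rows that is closed under dependency and on which \<open>v\<close> solves the homogeneous equations. Lowering
  \<open>q\<close> by a multiple of \<open>v\<close> on \<open>C\<close> would give a prefixed point below the least one.\<close>

lemma nonneg_if_D_le:
  assumes x: "0 \<le> x" "x \<le> q" and y: "\<And>i. D x y $ i \<le> y $ i"
  shows "0 \<le> y"
proof (rule ccontr)
  assume "\<not> 0 \<le> y"
  then obtain i0 where i0: "y $ i0 < 0" by (auto simp: less_eq_vec_def not_le)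
  \<comment> \<open>The least \<open>t\<close> for which \<open>y + t *\<^sub>R v\<close> is
    nonnegative; it is attained at \<open>i1\<close>, where \<open>e\<close> vanishes.\<close>
  define t where "t = Max (range (\<lambda>i. - (y $ i) / v $ i))"
  have t_ge: "- (y $ i) / v $ i \<le> t" for i unfolding t_def by (intro Max_ge) auto
  have "t \<in> range (\<lambda>i. - (y $ i) / v $ i)" unfolding t_def by (intro Max_in) auto
  then obtain i1 where i1: "t = - (y $ i1) / v $ i1" by blast
  have "0 < - (y $ i0) / v $ i0" using i0 v_pos by (intro divide_pos_pos) auto
  with t_ge[of i0] have t: "0 < t" by linarith
  define e where "e = y + t *\<^sub>R v"
  define C where "C = {i. e $ i = 0}"
  have "i1 \<in> C" using i1 v_pos[of i1] by (simp add: C_def e_def)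
  have e: "0 \<le> e $ i" for i
  proof -
    have "- (y $ i) \<le> t * v $ i" using t_ge[of i] v_pos[of i] by (subst (asm) pos_divide_le_eq)
    then show ?thesis by (simp add: e_def)
  qed
  \<comment> \<open>At a zero of \<open>e\<close>, the chain
    \<open>0 \<le> D x e \<le> e = 0\<close> forces equality in both \<open>D x y \<le> y\<close>
    and \<open>D x v \<le> v\<close>. The latter excludes product rows, and the nonnegative summands
    \<open>a i j * e $ j\<close> must all vanish.\<close>
  have C: "\<not> quad i \<and> (\<Sum>j\<in>UNIV. a i j * v $ j) = v $ i \<and> (\<forall>j. j \<notin> C \<longrightarrow> a i j = 0)"
    if "i \<in> C" for i
  proof -
    have De: "D x e $ i = D x y $ i + t * D x v $ i"
      by (simp only: e_def D_add D_scaleR vector_add_component vector_scaleR_component real_scaleR_def)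
    have "0 \<le> D x e $ i" using D_nonneg[OF x(1), of e] e by (simp add: less_eq_vec_def)
    moreover have yi: "y $ i + t * v $ i = 0" using that by (simp add: C_def e_def)
    moreover have "t * D x v $ i \<le> t * v $ i" using t D_v_le(1)[OF x(2), of i] by simp
    ultimately have eq: "t * D x v $ i = t * v $ i" and De0: "D x e $ i = 0"
      using De y[of i] by linarith+
    from eq t have Dv: "D x v $ i = v $ i" by simp
    then have nq: "\<not> quad i" using D_v_le(2)[OF x(2), of i] by auto
    from De0 have "(\<Sum>j\<in>UNIV. a i j * e $ j) = 0" by (simp add: D_linear[OF nq])
    then have "a i j * e $ j = 0" for j
      using a_nonneg[OF nq] e by (subst (asm) sum_nonneg_eq_0_iff) auto
    with Dv nq show ?thesis by (auto simp: C_def D_linear)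
  qed
  \<comment> \<open>Since \<open>v < 1\<close>, lowering \<open>q\<close> by \<open>m\<close> times
    \<open>v\<close> keeps every entry nonnegative.\<close>
  define m where "m = Min (range (\<lambda>i. q $ i))"
  have m_le: "m \<le> q $ i" for i unfolding m_def by (intro Min_le) auto
  have "m \<in> range (\<lambda>i. q $ i)" unfolding m_def by (intro Min_in) auto
  then have m: "0 < m" using q_pos by auto
  define z where "z = (\<chi> i. if i \<in> C then q $ i - m * v $ i else q $ i)"
  have "m * v $ i \<le> q $ i" for i
    using mult_left_mono[of "v $ i" 1 m] v_less_1[of i] m m_le[of i] by linarith
  then have "0 \<le> z" using q_pos by (auto simp: z_def less_eq_vec_def intro: less_imp_le)
  have "z \<le> q" using m v_pos by (auto simp: z_def less_eq_vec_def intro: less_imp_le)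
  \<comment> \<open>Rows in \<open>C\<close> depend on \<open>C\<close> only, where \<open>v\<close>
    solves the homogeneous equations, so they stay fixed; the other rows follow from
    monotonicity.\<close>
  have "F z $ i \<le> z $ i" for i
  proof (cases "i \<in> C")
    case True
    note Ci = C[OF True]
    have "F z $ i = c i + (\<Sum>j\<in>UNIV. a i j * (q $ j - m * v $ j))"
      using Ci by (auto simp: F_linear z_def intro!: sum.cong)
    also have "\<dots> = c i + (\<Sum>j\<in>UNIV. a i j * q $ j) - m * (\<Sum>j\<in>UNIV. a i j * v $ j)"
      by (simp only: right_diff_distrib sum_subtractf sum_distrib_left mult.left_commute[of m] add_diff_eq)
    also have "\<dots> = z $ i" using Ci F_linear[of i q] True by (simp add: F_q z_def)
    finally show ?thesis by simp
  next
    case False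
    then show ?thesis using F_mono[OF \<open>0 \<le> z\<close> \<open>z \<le> q\<close>] by (simp add: F_q z_def less_eq_vec_def)
  qed
  then have "q \<le> z" using \<open>0 \<le> z\<close> by (intro q_le_prefixpoint) (auto simp: less_eq_vec_def)
  then have "q $ i1 \<le> z $ i1" by (simp add: less_eq_vec_def)
  moreover have "0 < m * v $ i1" using m v_pos by (intro mult_pos_pos)
  ultimately show False using \<open>i1 \<in> C\<close> by (simp add: z_def)
qed

text \<open>A kernel vector and its negative both satisfy the hypothesis of
  \<open>nonneg_if_D_le\<close>, so the kernel is trivial.\<close>

lemma invertible_one_minus_D:
  assumes x: "0 \<le> x" "x \<le> q" and J: "\<And>y. J *v y = D x y"
  shows "invertible (mat 1 - J)"
proof -
  have "y = 0" if "(mat 1 - J) *v y = 0" for y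
  proof -
    have "D x y = y" using that by (simp add: matrix_vector_mult_diff_rdistrib J)
    moreover from this have "D x (- y) = - y" by (simp add: linear_neg[OF linear_D])
    ultimately have "0 \<le> y" "0 \<le> - y"
      by (rule_tac nonneg_if_D_le[OF x], simp only: order.refl)+
    then show ?thesis by simp
  qed
  then show ?thesis by (simp add: invertible_left_inverse matrix_left_invertible_ker)
qed

text \<open>The new error \<open>e\<close> satisfies \<open>(I - B(x)) e = R\<close>, where
  \<open>R\<close> is the quadratic Taylor remainder. Both claims are comparisons by
  \<open>nonneg_if_D_le\<close>: \<open>0 \<le> R\<close> gives the first, and
  \<open>R \<le> (t / 2) (I - B(x)) v\<close> the second.\<close>

lemma newton_step:
  assumes x: "0 \<le> x" "x \<le> q" and J: "\<And>y. J *v y = D x y"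
    and y: "y = x + matrix_inv (mat 1 - J) *v (F x - x)"
  shows "y \<le> q" and "q - x \<le> t *\<^sub>R v \<Longrightarrow> q - y \<le> (t / 2) *\<^sub>R v"
proof -
  define e where "e = q - y"
  have "(mat 1 - J) *v (y - x) = F x - x"
    unfolding y add_diff_cancel_left'
    by (simp only: matrix_vector_mul_assoc matrix_mul_matrix_inv[OF invertible_one_minus_D[OF x J]]
        matrix_vector_mul_lid)
  then have "y - x - D x (y - x) = F x - x"
    by (simp add: matrix_vector_mult_diff_rdistrib J)
  moreover have "D x (q - x) = D x e + D x (y - x)"
    by (simp add: e_def flip: D_add)
  ultimately have e_vec: "e - D x e = F q - F x - D x (q - x)"
    by (simp add: e_def F_q algebra_simps)
  have e: "e $ i - D x e $ i = (if quad i then (q - x) $ l i * (q - x) $ r i else 0)" for i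
    using arg_cong[OF e_vec, of "\<lambda>u. u $ i"] F_diff[of q x i] by simp
  have d: "0 \<le> (q - x) $ i" for i using x(2) by (simp add: less_eq_vec_def)
  have "0 \<le> e"
  proof (rule nonneg_if_D_le[OF x])
    fix i
    have "0 \<le> (q - x) $ l i * (q - x) $ r i" using d by (intro mult_nonneg_nonneg)
    with e[of i] show "D x e $ i \<le> e $ i" by (simp split: if_splits)
  qed
  then show "y \<le> q" by (simp add: e_def)
  assume t: "q - x \<le> t *\<^sub>R v"
  have "0 \<le> (t / 2) *\<^sub>R v - e"
  proof (rule nonneg_if_D_le[OF x])
    fix i
    have Deq: "D x ((t / 2) *\<^sub>R v - e) $ i = t / 2 * D x v $ i - D x e $ i"
      by (simp only: linear_diff[OF linear_D] D_scaleR vector_minus_component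
          vector_scaleR_component real_scaleR_def)
    have t': "(q - x) $ j \<le> t * v $ j" for j using t by (simp add: less_eq_vec_def)
    have t0: "0 \<le> t" using order.trans[OF d t', of i] v_pos[of i] by (simp add: zero_le_mult_iff)
    have "e $ i - D x e $ i \<le> t / 2 * (v $ i - D x v $ i)"
    proof (cases "quad i")
      case True
      let ?d = "\<lambda>j. (q - x) $ j"
      have "?d (l i) * ?d (r i) \<le> ?d (l i) * (t * v $ r i)"
        by (intro mult_left_mono t' d)
      moreover have "?d (l i) * ?d (r i) \<le> (t * v $ l i) * ?d (r i)"
        by (intro mult_right_mono t' d)
      moreover have "0 \<le> t * (v $ l i * v $ r i)"
        using t0 v_pos by (intro mult_nonneg_nonneg) (auto intro: less_imp_le)
      \<comment> \<open>The average of the two bounds on \<open>A * B\<close>, with a nonnegative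
        term added.\<close>
      moreover have "A * B \<le> t / 2 * (A * s + B * p + p * s)"
        if "A * B \<le> A * (t * s)" "A * B \<le> (t * p) * B" "0 \<le> t * (p * s)" for A B p s
        using that by (simp add: algebra_simps)
      ultimately have "?d (l i) * ?d (r i) \<le>
          t / 2 * (?d (l i) * v $ r i + ?d (r i) * v $ l i + v $ l i * v $ r i)"
        by blast
      then show ?thesis using e[of i] True D_v_quad[OF True, of x] by simp
    next
      case False
      then show ?thesis using e[of i] t0 D_v_le(1)[OF x(2), of i] by simp
    qed
    then show "D x ((t / 2) *\<^sub>R v - e) $ i \<le> ((t / 2) *\<^sub>R v - e) $ i"
      unfolding Deq by (simp add: algebra_simps)
  qed
  then show "q - y \<le> (t / 2) *\<^sub>R v" by (simp add: e_def)
qed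

text \<open>Scaling a point \<open>x\<close> of the polyhedron by \<open>2 ^ - (4 * N)\<close> makes the quadratic terms negligible
  against the slack 1 of the product rows, and keeps it below every nonzero deficit
  \<open>1 - c i - (\<Sum>j. a i j)\<close>; rows with a nonzero deficit therefore need no constraint.\<close>

lemma v_lower_bound:
  fixes den :: "'n \<Rightarrow> real" and s :: "'n \<Rightarrow> nat"
  assumes den_pos: "\<And>i. \<not> quad i \<Longrightarrow> 0 < den i"
    and den_le: "\<And>i. \<not> quad i \<Longrightarrow> den i \<le> 2 ^ s i"
    and den_a: "\<And>i j. \<not> quad i \<Longrightarrow> den i * a i j \<in> \<int>"
    and den_c: "\<And>i. \<not> quad i \<Longrightarrow> den i * c i \<in> \<int>"
    and den_int: "\<And>i. den i \<in> \<int>"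
    and s_quad: "\<And>i. quad i \<Longrightarrow> 1 \<le> s i"
    and N: "CARD('n) + (\<Sum>i\<in>UNIV. s i) \<le> N"
  shows "1 / 2 ^ (4 * N) \<le> v $ i"
proof -
  define tight where "tight i \<longleftrightarrow> c i + (\<Sum>j\<in>UNIV. a i j) = 1" for i
  define row :: "'n \<Rightarrow> real ^ 'n" where
    "row i = (if quad i then axis (l i) 1 + axis (r i) 1 - axis i 1
      else if tight i then (\<chi> j. den i * a i j - (if j = i then den i else 0)) else 0)" for i
  \<comment> \<open>The flag \<open>True\<close> selects the constraint that entry \<open>i\<close>
    is at least 1, \<open>False\<close> the constraint coming from row \<open>i\<close> of the
    system.\<close>
  define A :: "'n \<times> bool \<Rightarrow> real ^ 'n" where
    "A p = (if snd p then axis (fst p) 1 else row (fst p))" for p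
  define b :: "'n \<times> bool \<Rightarrow> real" where
    "b p = (if snd p \<or> quad (fst p) then 1 else 0)" for p
  define w :: "'n \<times> bool \<Rightarrow> real" where
    "w p = (if snd p then 2 else 2 ^ (1 + s (fst p)))" for p
  have row_quad: "row i \<bullet> x = x $ l i + x $ r i - x $ i" if "quad i" for i x
    using that by (simp add: row_def inner_add_left inner_diff_left inner_axis')
  have row_tight: "row i \<bullet> x = den i * ((\<Sum>j\<in>UNIV. a i j * x $ j) - x $ i)"
    if "\<not> quad i" "tight i" for i x
  proof -
    have "row i \<bullet> x = (\<Sum>j\<in>UNIV. den i * (a i j * x $ j) - (if j = i then den i * x $ j else 0))"
      unfolding row_def inner_vec_def using that by (intro sum.cong refl) (simp add: algebra_simps)
    then show ?thesis by (simp add: sum_subtractf sum_distrib_left right_diff_distrib)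
  qed
  have row_other: "row i = 0" if "\<not> quad i" "\<not> tight i" for i
    using that by (simp add: row_def)
  define m where "m = Min (range (\<lambda>i. v $ i))"
  have m_le: "m \<le> v $ i" for i unfolding m_def by (intro Min_le) auto
  have "m \<in> range (\<lambda>i. v $ i)" unfolding m_def by (intro Min_in) auto
  then have m: "0 < m" "m < 1" using v_pos v_less_1 by auto
  have m2: "m\<^sup>2 \<le> v $ i" for i
  proof -
    have "m * m \<le> m * 1" using m by (intro mult_left_mono) auto
    then show ?thesis using m_le[of i] by (simp only: power2_eq_square)
  qed
  \<comment> \<open>Dividing by \<open>m\<^sup>2\<close> suffices: \<open>m\<^sup>2\<close> is below
    every entry of \<open>v\<close>, and in a product row it is below the slack
    \<open>v $ l i * v $ r i\<close>.\<close>
  have feasible: "b p \<le> A p \<bullet> ((1 / m\<^sup>2) *\<^sub>R v)" for p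
  proof -
    obtain i t where p: "p = (i, t)" by (cases p)
    have "b p * m\<^sup>2 \<le> A p \<bullet> v"
    proof (cases t)
      case True
      then show ?thesis using m2[of i] by (simp add: p A_def b_def inner_axis')
    next
      case False
      consider "quad i" | "\<not> quad i" "tight i" | "\<not> quad i" "\<not> tight i" by blast
      then show ?thesis
      proof cases
        case 1
        have "m * m \<le> v $ l i * v $ r i"
          using m v_pos by (intro mult_mono m_le) (auto intro: less_imp_le)
        then show ?thesis using 1 False v_quad[OF 1]
          by (simp add: p A_def b_def row_quad power2_eq_square)
      next
        case 2
        then show ?thesis using False sum_a_v[OF 2(1)]
          by (simp add: p A_def b_def row_tight tight_def)
      next
        case 3
        then show ?thesis using False by (simp add: p A_def b_def row_other)
      qed
    qed
    then show ?thesis using m by (simp add: pos_le_divide_eq)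
  qed
  have weight: "(\<Sum>j\<in>UNIV. \<bar>A p $ j\<bar>) + \<bar>b p\<bar> \<le> w p" for p
  proof -
    obtain i t where p: "p = (i, t)" by (cases p)
    consider "t" | "\<not> t" "quad i" | "\<not> t" "\<not> quad i" "tight i" | "\<not> t" "\<not> quad i" "\<not> tight i"
      by blast
    then show ?thesis
    proof cases
      case 1
      then show ?thesis by (simp add: p A_def b_def w_def sum_abs_axis)
    next
      case 2
      have "(\<Sum>j\<in>UNIV. \<bar>row i $ j\<bar>) \<le>
          (\<Sum>j\<in>UNIV. \<bar>(axis (l i) 1 :: real ^ 'n) $ j\<bar> + \<bar>(axis (r i) 1 :: real ^ 'n) $ j\<bar>
            + \<bar>(axis i 1 :: real ^ 'n) $ j\<bar>)"
        unfolding row_def using 2 by (intro sum_mono) simp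
      also have "\<dots> = 3" by (simp add: sum.distrib sum_abs_axis)
      finally have "(\<Sum>j\<in>UNIV. \<bar>row i $ j\<bar>) + 1 \<le> 2 ^ 2" by simp
      \<comment> \<open>A product row has weight at most 3 + 1, which is where
        \<open>1 \<le> s i\<close> enters.\<close>
      also have "\<dots> \<le> 2 ^ (1 + s i)" using s_quad[OF 2(2)] by (intro power_increasing) auto
      finally show ?thesis using 2 by (simp add: p A_def b_def w_def)
    next
      case 3
      have "(\<Sum>j\<in>UNIV. \<bar>row i $ j\<bar>) \<le> (\<Sum>j\<in>UNIV. den i * a i j + (if j = i then den i else 0))"
      proof (intro sum_mono)
        fix j
        have "0 \<le> den i * a i j"
          using den_pos[OF 3(2)] a_nonneg[OF 3(2)] by (intro mult_nonneg_nonneg) auto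
        then show "\<bar>row i $ j\<bar> \<le> den i * a i j + (if j = i then den i else 0)"
          unfolding row_def using 3 den_pos[OF 3(2)] by (cases "j = i") (auto simp: abs_le_iff)
      qed
      also have "\<dots> = den i * (\<Sum>j\<in>UNIV. a i j) + den i"
        by (simp add: sum.distrib sum_distrib_left)
      also have "\<dots> \<le> den i * 1 + den i"
        using den_pos[OF 3(2)] ac_le_1[OF 3(2)] c_nonneg[OF 3(2)]
        by (intro add_mono mult_left_mono) auto
      finally show ?thesis using 3 den_le[OF 3(2)] by (simp add: p A_def b_def w_def)
    next
      case 4
      then show ?thesis by (simp add: p A_def b_def w_def row_other)
    qed
  qed
  have "\<exists>x. (\<forall>p. b p \<le> A p \<bullet> x) \<and> (\<forall>k. \<bar>x $ k\<bar> \<le> (\<Prod>p\<in>UNIV. w p))"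
  proof (rule bounded_solution_of_integer_inequalities)
    show "A p $ j \<in> \<int>" for p j
    proof -
      have [simp]: "(axis k 1 :: real ^ 'n) $ j \<in> \<int>" for k by (simp add: axis_def)
      show ?thesis
        by (cases p) (auto simp: A_def row_def den_a den_int intro!: Ints_add Ints_diff)
    qed
    show "b p \<le> A p \<bullet> ((1 / m\<^sup>2) *\<^sub>R v)" for p by (rule feasible)
    show "y = 0" if "\<And>p. A p \<bullet> y = 0" for y
    proof -
      have "y $ i = 0" for i using that[of "(i, True)"] by (simp add: A_def inner_axis')
      then show ?thesis by (simp add: vec_eq_iff)
    qed
    show "1 \<le> w p" for p
      using one_le_power[of "2::real" "1 + s (fst p)"] by (simp add: w_def)
    show "(\<Sum>j\<in>UNIV. \<bar>A p $ j\<bar>) + \<bar>b p\<bar> \<le> w p" for p by (rule weight)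
  qed
  then obtain x where x: "\<And>p. b p \<le> A p \<bullet> x" "\<And>k. \<bar>x $ k\<bar> \<le> (\<Prod>p\<in>UNIV. w p)"
    by blast
  have "(\<Prod>p\<in>UNIV. w p) = (\<Prod>i\<in>UNIV. \<Prod>t\<in>UNIV. w (i, t))"
    by (simp add: prod.cartesian_product)
  also have "\<dots> = (\<Prod>i\<in>UNIV. 2 ^ (2 + s i))"
    by (simp add: w_def UNIV_bool)
  also have "\<dots> = 2 ^ (2 * CARD('n) + (\<Sum>i\<in>UNIV. s i))"
    by (simp add: prod.distrib power_add power_mult power_sum)
  also have "\<dots> \<le> 2 ^ (2 * N)" using N by (intro power_increasing) auto
  finally have x_le: "x $ k \<le> 2 ^ (2 * N)" for k using x(2)[of k] by linarith
  have x_ge: "1 \<le> x $ k" for k using x(1)[of "(k, True)"] by (simp add: A_def b_def inner_axis')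
  \<comment> \<open>\<open>\<epsilon>\<close> is the inverse square of the bound
    \<open>2 ^ (2 * N)\<close> on the entries of \<open>x\<close>, so products of two entries scale
    to at most 1.\<close>
  define \<epsilon> :: real where "\<epsilon> = 1 / 2 ^ (4 * N)"
  have \<epsilon>: "0 < \<epsilon>" by (simp add: \<epsilon>_def)
  have \<epsilon>_MM: "\<epsilon> * (2 ^ (2 * N) * 2 ^ (2 * N)) = 1"
    by (simp add: \<epsilon>_def flip: power_add)
  then have \<epsilon>_M: "\<epsilon> * 2 ^ (2 * N) = 1 / 2 ^ (2 * N)" by (simp add: field_simps)
  have \<epsilon>_x: "\<epsilon> * x $ k \<le> 1 / 2 ^ (2 * N)" for k
    using mult_left_mono[OF x_le, of \<epsilon> k] \<epsilon> \<epsilon>_M by simp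
  define z where "z = 1 - \<epsilon> *\<^sub>R x"
  have "\<epsilon> * x $ k \<le> 1" for k by (rule order.trans[OF \<epsilon>_x]) simp
  then have z0: "0 \<le> z" by (simp add: z_def less_eq_vec_def)
  have "F z $ i \<le> z $ i" for i
  proof -
    consider "quad i" | "\<not> quad i" "tight i" | "\<not> quad i" "\<not> tight i" by blast
    then show ?thesis
    proof cases
      case 1
      have "x $ l i * x $ r i \<le> 2 ^ (2 * N) * 2 ^ (2 * N)"
        using x_le x_ge by (intro mult_mono) (auto intro: order.trans[OF zero_le_one])
      then have "\<epsilon> * (x $ l i * x $ r i) \<le> 1"
        using mult_left_mono[of "x $ l i * x $ r i" "2 ^ (2 * N) * 2 ^ (2 * N)" \<epsilon>] \<epsilon> \<epsilon>_MM by simp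
      also have "1 \<le> x $ l i + x $ r i - x $ i"
        using x(1)[of "(i, False)"] 1 by (simp add: A_def b_def row_quad)
      finally have "\<epsilon> * (\<epsilon> * (x $ l i * x $ r i)) \<le> \<epsilon> * (x $ l i + x $ r i - x $ i)"
        using \<epsilon> by (intro mult_left_mono) auto
      \<comment> \<open>With \<open>z = 1 - \<epsilon> x\<close> the product row reads \<open>1 -
        \<epsilon> (x_l + x_r) + \<epsilon>^2 x_l x_r \<le> 1 - \<epsilon> x_i\<close>, the
        inequality just obtained.\<close>
      then show ?thesis using 1 by (simp add: F_quad z_def algebra_simps)
    next
      case 2
      have "0 \<le> den i * ((\<Sum>j\<in>UNIV. a i j * x $ j) - x $ i)"
        using x(1)[of "(i, False)"] 2 by (simp add: A_def b_def row_tight)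
      then have "x $ i \<le> (\<Sum>j\<in>UNIV. a i j * x $ j)"
        using den_pos[OF 2(1)] by (simp add: zero_le_mult_iff)
      then have "\<epsilon> * x $ i \<le> \<epsilon> * (\<Sum>j\<in>UNIV. a i j * x $ j)"
        using \<epsilon> by (intro mult_left_mono) auto
      moreover have "F z $ i = c i + (\<Sum>j\<in>UNIV. a i j) - \<epsilon> * (\<Sum>j\<in>UNIV. a i j * x $ j)"
        using 2 by (simp add: F_linear z_def right_diff_distrib sum_subtractf sum_distrib_left
            mult.left_commute)
      ultimately show ?thesis using 2 by (simp add: tight_def z_def)
    next
      case 3
      let ?d = "1 - (c i + (\<Sum>j\<in>UNIV. a i j))"
      have d: "0 < ?d" using 3 ac_le_1[OF 3(1)] by (simp add: tight_def)
      \<comment> \<open>The cleared deficit is a positive integer, hence at least 1; so the deficit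
        is at least \<open>1 / 2 ^ s i\<close>.\<close>
      have "den i * ?d = den i - den i * c i - (\<Sum>j\<in>UNIV. den i * a i j)"
        by (simp add: algebra_simps sum_distrib_left)
      also have "\<dots> \<in> \<int>"
        using 3 by (intro Ints_diff Ints_sum den_int den_c den_a)
      finally have "1 \<le> \<bar>den i * ?d\<bar>"
        using d den_pos[OF 3(1)] by (intro Ints_nonzero_abs_ge1) auto
      then have "1 \<le> den i * ?d" using d den_pos[OF 3(1)] by (simp add: abs_mult)
      also have "\<dots> \<le> 2 ^ s i * ?d" using d den_le[OF 3(1)] by (intro mult_right_mono) auto
      also have "\<dots> \<le> 2 ^ (2 * N) * ?d"
      proof -
        have "s i \<le> (\<Sum>i\<in>UNIV. s i)" by (intro member_le_sum) auto
        then show ?thesis using N d by (intro mult_right_mono power_increasing) auto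
      qed
      finally have "1 / 2 ^ (2 * N) \<le> ?d" by (simp add: pos_divide_le_eq mult.commute)
      then have "\<epsilon> * x $ i \<le> ?d" using \<epsilon>_x[of i] by linarith
      moreover have "0 \<le> \<epsilon> * x $ k" for k
        using \<epsilon> order.trans[OF zero_le_one x_ge] by (intro mult_nonneg_nonneg) auto
      then have "F z $ i \<le> c i + (\<Sum>j\<in>UNIV. a i j * 1)"
        unfolding F_linear[OF 3(1)] using a_nonneg[OF 3(1)]
        by (intro add_left_mono sum_mono mult_left_mono) (auto simp: z_def)
      ultimately show ?thesis by (simp add: z_def)
    qed
  qed
  then have "q \<le> z" using z0 by (intro q_le_prefixpoint) (auto simp: less_eq_vec_def)
  then have "\<epsilon> * x $ i \<le> v $ i" by (simp add: z_def less_eq_vec_def algebra_simps)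
  moreover have "\<epsilon> * 1 \<le> \<epsilon> * x $ i" using \<epsilon> x_ge by (intro mult_left_mono) auto
  ultimately show ?thesis by (simp add: \<epsilon>_def)
qed

section \<open>Convergence of the rounded iteration\<close>

text \<open>Measured in multiples of \<open>v\<close>, one rounded step maps the error bound
  \<open>t\<close> to \<open>t / 2 + 1 / (\<delta> * 2 ^ h)\<close>. The summand
  \<open>2 / (\<delta> * 2 ^ h)\<close> is the fixed point of this map, and the other summand halves
  in each step.\<close>

lemma rounded_newton_bounds:
  fixes X :: "nat \<Rightarrow> real ^ 'n" and J :: "nat \<Rightarrow> real ^ 'n ^ 'n"
  assumes X_0: "X 0 = 0"
    and X_Suc: "\<And>k. X (Suc k) = (\<chi> i. round_down h
      ((X k + matrix_inv (mat 1 - J k) *v (F (X k) - X k)) $ i))"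
    and J: "\<And>k y. J k *v y = D (X k) y"
  shows "0 \<le> X k" and "X k \<le> q"
    and "(\<And>i. \<delta> \<le> v $ i) \<Longrightarrow> 0 < \<delta> \<Longrightarrow>
      q - X k \<le> (1 / (\<delta> * 2 ^ k) + 2 / (\<delta> * 2 ^ h)) *\<^sub>R v"
proof -
  define Y where "Y k = X k + matrix_inv (mat 1 - J k) *v (F (X k) - X k)" for k
  have X_Suc': "X (Suc k) $ i = round_down h (Y k $ i)" for k i
    by (simp add: X_Suc Y_def)
  have X_nonneg: "0 \<le> X k" for k
    by (cases k) (auto simp: X_0 X_Suc' less_eq_vec_def round_down_bounds(1))
  show "0 \<le> X k" by (rule X_nonneg)
  have X_le: "X k \<le> q" for k
  proof (induction k)
    case 0
    show ?case using q_pos by (auto simp: X_0 less_eq_vec_def intro: less_imp_le)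
  next
    case (Suc k)
    have "Y k \<le> q" by (rule newton_step(1)[OF X_nonneg Suc J Y_def])
    then have "max (Y k $ i) 0 \<le> q $ i" for i
      using q_pos[of i] by (simp add: less_eq_vec_def less_imp_le)
    then show ?case
      using order.trans[OF round_down_bounds(2)] by (simp add: X_Suc' less_eq_vec_def)
  qed
  show "X k \<le> q" by (rule X_le)
  assume \<delta>: "\<And>i. \<delta> \<le> v $ i" "0 < \<delta>"
  show "q - X k \<le> (1 / (\<delta> * 2 ^ k) + 2 / (\<delta> * 2 ^ h)) *\<^sub>R v"
  proof (induction k)
    case 0
    have "q $ i \<le> (1 / \<delta> + 2 / (\<delta> * 2 ^ h)) * v $ i" for i
    proof -
      have "q $ i \<le> 1 / \<delta> * \<delta>" using q_less_1[of i] \<delta>(2) by simp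
      also have "\<dots> \<le> 1 / \<delta> * v $ i" using \<delta> by (intro mult_left_mono) auto
      also have "\<dots> \<le> (1 / \<delta> + 2 / (\<delta> * 2 ^ h)) * v $ i"
        using \<delta>(2) v_pos[of i] by (intro mult_right_mono) auto
      finally show ?thesis .
    qed
    then show ?case by (simp add: X_0 less_eq_vec_def)
  next
    case (Suc k)
    let ?t = "1 / (\<delta> * 2 ^ k) + 2 / (\<delta> * 2 ^ h)"
    have Y: "q - Y k \<le> (?t / 2) *\<^sub>R v"
      by (rule newton_step(2)[OF X_nonneg X_le J Y_def Suc])
    have "(q - X (Suc k)) $ i \<le> (1 / (\<delta> * 2 ^ Suc k) + 2 / (\<delta> * 2 ^ h)) * v $ i" for i
    proof -
      have "(q - X (Suc k)) $ i \<le> (q - Y k) $ i + 1 / 2 ^ h"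
        using round_down_bounds(3)[of "Y k $ i" h] by (simp add: X_Suc')
      also have "(q - Y k) $ i \<le> ?t / 2 * v $ i"
        using Y by (simp only: less_eq_vec_def vector_scaleR_component real_scaleR_def)
      also have "1 / 2 ^ h \<le> 1 / (\<delta> * 2 ^ h) * v $ i"
        using \<delta> by (simp add: field_simps)
      also have "?t / 2 * v $ i + 1 / (\<delta> * 2 ^ h) * v $ i =
          (1 / (\<delta> * 2 ^ Suc k) + 2 / (\<delta> * 2 ^ h)) * v $ i"
        by (simp add: add_divide_distrib distrib_right)
      finally show ?thesis by simp
    qed
    then show ?case by (simp only: less_eq_vec_def vector_scaleR_component real_scaleR_def) simp
  qed
qed

end

section \<open>Polynomials in simple normal form\<close>

text \<open>The support lies among the constant and the single variables, which are distinct
  monomials. The second assumption lets the sum run over all of them, present or not.\<close>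

lemma sum_keys_linear_form:
  fixes p :: "'n::finite qpoly" and f :: "'n mon \<Rightarrow> 'b::comm_monoid_add"
  assumes "is_linear_form p" and "\<And>m. Poly_Mapping.lookup p m = 0 \<Longrightarrow> f m = 0"
  shows "(\<Sum>m\<in>Poly_Mapping.keys p. f m) = f 0 + (\<Sum>j\<in>UNIV. f (Poly_Mapping.single j 1))"
proof -
  let ?S = "range (\<lambda>j::'n. Poly_Mapping.single j (1::nat))"
  have inj: "inj (\<lambda>j::'n. Poly_Mapping.single j (1::nat))"
    by (rule injI) (metis lookup_single_eq lookup_single_not_eq one_neq_zero)
  have "Poly_Mapping.single j (1::nat) \<noteq> 0" for j :: 'n
    by (metis lookup_single_eq lookup_zero one_neq_zero)
  then have "0 \<notin> ?S" by (metis imageE)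
  have "(\<Sum>m\<in>Poly_Mapping.keys p. f m) = (\<Sum>m\<in>insert 0 ?S. f m)"
    using assms by (intro sum.mono_neutral_left) (auto simp: is_linear_form_def in_keys_iff)
  also have "\<dots> = f 0 + (\<Sum>m\<in>?S. f m)"
    using \<open>0 \<notin> ?S\<close> by (simp add: sum.insert)
  finally show ?thesis using inj by (simp add: sum.reindex)
qed

lemma prod_power_lookup_single:
  "(\<Prod>i\<in>UNIV. (x $ i) ^ Poly_Mapping.lookup (Poly_Mapping.single (j::'n::finite) 1) i) = (x $ j :: real)"
proof -
  have "(x $ i) ^ Poly_Mapping.lookup (Poly_Mapping.single j 1) i = (if i = j then x $ i else 1)" for i
    by (simp add: lookup_single when_def)
  then show ?thesis by simp
qed

lemma poly_eval_linear_form: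
  assumes "is_linear_form p"
  shows "poly_eval p x = of_rat (Poly_Mapping.lookup p 0) +
    (\<Sum>j\<in>UNIV. of_rat (Poly_Mapping.lookup p (Poly_Mapping.single j 1)) * x $ j)"
  unfolding poly_eval_def
  by (subst sum_keys_linear_form[OF assms]) (simp_all add: prod_power_lookup_single del: One_nat_def)

lemma poly_eval_product:
  "poly_eval (Poly_Mapping.single (Poly_Mapping.single j 1 + Poly_Mapping.single k 1) 1) x = x $ j * x $ k"
  by (simp add: poly_eval_def lookup_add power_add prod.distrib prod_power_lookup_single
      del: One_nat_def)

section \<open>Common denominators and bit sizes\<close>

text \<open>A common denominator of the coefficients. With the product instead of the least common
  multiple, the bound by a power of 2 follows factor by factor.\<close>

definition coeff_denom :: "'n qpoly \<Rightarrow> int" where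
  "coeff_denom p = (\<Prod>m\<in>Poly_Mapping.keys p. snd (quotient_of (Poly_Mapping.lookup p m)))"

lemma coeff_denom_pos: "0 < coeff_denom p"
  by (auto simp: coeff_denom_def intro!: prod_pos quotient_of_denom_pos')

lemma coeff_denom_mult_lookup:
  "real_of_int (coeff_denom p) * of_rat (Poly_Mapping.lookup p m) \<in> \<int>"
proof (cases "m \<in> Poly_Mapping.keys p")
  case True
  obtain n d where nd: "quotient_of (Poly_Mapping.lookup p m) = (n, d)" by fastforce
  have "d dvd coeff_denom p"
    using dvd_prodI[OF finite_keys True, of "\<lambda>m. snd (quotient_of (Poly_Mapping.lookup p m))"] nd
    by (simp add: coeff_denom_def)
  then obtain e where e: "coeff_denom p = d * e" ..
  have "Poly_Mapping.lookup p m = of_int n / of_int d" by (rule quotient_of_div[OF nd])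
  moreover have "d \<noteq> 0" using quotient_of_denom_pos[OF nd] by simp
  ultimately have "real_of_int (coeff_denom p) * of_rat (Poly_Mapping.lookup p m) = of_int (e * n)"
    by (simp add: e of_rat_divide)
  then show ?thesis by simp
next
  case False
  then show ?thesis by (simp add: in_keys_iff)
qed

lemma denom_le_rat_bits: "real_of_int (snd (quotient_of r)) \<le> 2 ^ rat_bits r"
proof -
  obtain n d where nd: "quotient_of r = (n, d)" by fastforce
  have d: "0 < d" by (rule quotient_of_denom_pos[OF nd])
  then have "nat d < 2 ^ floorlog 2 (nat d)" using floorlog_bounds[of "nat d" 2] by simp
  then have "real (nat d) < 2 ^ floorlog 2 (nat d)" by (metis of_nat_less_iff of_nat_numeral of_nat_power)
  also have "\<dots> \<le> 2 ^ rat_bits r" by (intro power_increasing) (auto simp: rat_bits_def nd)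
  finally show ?thesis using d by (simp add: nd)
qed

theorem theorem4p2:
  fixes P :: "'n::finite system" and q :: "real ^ 'n" and j h :: nat
  assumes "is_PPS P"
    and "is_simple_normal_form P"
    and "is_LFP P q"
    and "\<And>i. 0 < q $ i" and "\<And>i. q $ i < 1"
    and "h = j + 2 + 4 * system_size P"
  shows "rounded_newton_well_defined P h
    \<and> (\<forall>k. 0 \<le> rounded_newton P h k \<and> rounded_newton P h k \<le> q)
    \<and> infnorm (q - rounded_newton P h (j + 2 + 4 * system_size P)) \<le> 1 / 2 ^ j"
proof -
  define quad where "quad i \<longleftrightarrow> is_product_form (P i)" for i
  have "\<forall>i. \<exists>l r. quad i \<longrightarrow>
      P i = Poly_Mapping.single (Poly_Mapping.single l 1 + Poly_Mapping.single r 1) 1"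
    by (auto simp: quad_def is_product_form_def)
  then obtain l r where lr: "\<And>i. quad i \<Longrightarrow>
      P i = Poly_Mapping.single (Poly_Mapping.single (l i) 1 + Poly_Mapping.single (r i) 1) 1"
    by metis
  define a :: "'n \<Rightarrow> 'n \<Rightarrow> real" where
    "a i j = of_rat (Poly_Mapping.lookup (P i) (Poly_Mapping.single j 1))" for i j
  define c :: "'n \<Rightarrow> real" where "c i = of_rat (Poly_Mapping.lookup (P i) 0)" for i
  have lin: "is_linear_form (P i)" if "\<not> quad i" for i
    using that assms(2) by (auto simp: quad_def is_simple_normal_form_def)
  interpret snf_system quad l r a c
  proof
    fix i assume i: "\<not> quad i"
    show "0 \<le> a i j" for j using assms(1) by (simp add: a_def is_PPS_def)
    show "0 \<le> c i" using assms(1) by (simp add: c_def is_PPS_def)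
    have "(\<Sum>m\<in>Poly_Mapping.keys (P i). Poly_Mapping.lookup (P i) m) \<le> 1"
      using assms(1) by (simp add: is_PPS_def)
    then have "real_of_rat (Poly_Mapping.lookup (P i) 0 +
        (\<Sum>j\<in>UNIV. Poly_Mapping.lookup (P i) (Poly_Mapping.single j 1))) \<le> 1"
      by (subst (asm) sum_keys_linear_form[OF lin[OF i]]) simp_all
    then show "c i + (\<Sum>j\<in>UNIV. a i j) \<le> 1"
      by (simp add: a_def c_def of_rat_add of_rat_sum)
  qed
  have F: "system_eval P = F"
  proof (intro ext iffD2[OF vec_eq_iff] allI)
    fix x i
    show "system_eval P x $ i = F x $ i"
    proof (cases "quad i")
      case True
      then show ?thesis by (simp add: system_eval_def F_quad lr poly_eval_product del: One_nat_def)
    next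
      case False
      then show ?thesis
        by (simp add: system_eval_def F_linear poly_eval_linear_form[OF lin] a_def c_def)
    qed
  qed
  interpret snf_system_lfp quad l r a c q
    using assms(3-5) by unfold_locales (auto simp: is_LFP_def F)
  define X where "X = rounded_newton P h"
  have J: "Jac P x *v y = D x y" for x y
    by (simp add: Jac_def F jacobian_F)
  have X_0: "X 0 = 0" by (simp add: X_def)
  have X_Suc: "X (Suc k) = (\<chi> i. round_down h
      ((X k + matrix_inv (mat 1 - Jac P (X k)) *v (F (X k) - X k)) $ i))" for k
    by (simp add: X_def newton_op_def F)
  note bounds = rounded_newton_bounds[of X h "\<lambda>k. Jac P (X k)", OF X_0 X_Suc J]
  have "rounded_newton_well_defined P h"
    unfolding rounded_newton_well_defined_def X_def[symmetric]
    by (intro allI invertible_one_minus_D[OF bounds(1,2) J])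
  moreover have "\<forall>k. 0 \<le> rounded_newton P h k \<and> rounded_newton P h k \<le> q"
    using bounds(1,2) by (simp add: X_def)
  moreover have "infnorm (q - rounded_newton P h (j + 2 + 4 * system_size P)) \<le> 1 / 2 ^ j"
  proof -
    let ?N = "system_size P"
    \<comment> \<open>\<open>s i\<close> is the contribution of row \<open>i\<close> to the size of
      \<open>P\<close>, so \<open>system_size P\<close> is the number of variables plus the sum of
      all \<open>s i\<close>.\<close>
    define s where "s i = (\<Sum>m\<in>Poly_Mapping.keys (P i). rat_bits (Poly_Mapping.lookup (P i) m) +
        (\<Sum>j\<in>Poly_Mapping.keys m. floorlog 2 (Poly_Mapping.lookup m j)))" for i
    define \<delta> :: real where "\<delta> = 1 / 2 ^ (4 * ?N)"
    have "\<delta> \<le> v $ i" for i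
      unfolding \<delta>_def
    proof (rule v_lower_bound[where den = "\<lambda>i. of_int (coeff_denom (P i))" and s = s])
      fix i
      show "(0::real) < of_int (coeff_denom (P i))" by (simp add: coeff_denom_pos)
      have "real_of_int (coeff_denom (P i)) \<le>
          (\<Prod>m\<in>Poly_Mapping.keys (P i). 2 ^ rat_bits (Poly_Mapping.lookup (P i) m))"
        unfolding coeff_denom_def of_int_prod
        by (intro prod_mono conjI denom_le_rat_bits)
          (simp add: less_imp_le[OF quotient_of_denom_pos'])
      also have "\<dots> = 2 ^ (\<Sum>m\<in>Poly_Mapping.keys (P i). rat_bits (Poly_Mapping.lookup (P i) m))"
        by (simp add: power_sum)
      also have "\<dots> \<le> 2 ^ s i"
        unfolding s_def by (intro power_increasing sum_mono) auto
      finally show "real_of_int (coeff_denom (P i)) \<le> 2 ^ s i" .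
      show "real_of_int (coeff_denom (P i)) * a i j \<in> \<int>" for j
        unfolding a_def by (rule coeff_denom_mult_lookup)
      show "real_of_int (coeff_denom (P i)) * c i \<in> \<int>"
        unfolding c_def by (rule coeff_denom_mult_lookup)
      show "real_of_int (coeff_denom (P i)) \<in> \<int>" by simp
      show "1 \<le> s i" if "quad i"
        using floorlog_bounds[of 1 2]
        by (simp add: s_def lr[OF that] rat_bits_def floorlog_def)
    next
      show "CARD('n) + (\<Sum>i\<in>UNIV. s i) \<le> ?N" by (simp add: system_size_def s_def)
    qed
    moreover have "0 < \<delta>" by (simp add: \<delta>_def)
    ultimately have X: "q - X k \<le> (1 / (\<delta> * 2 ^ k) + 2 / (\<delta> * 2 ^ h)) *\<^sub>R v" for k
      by (rule bounds(3))
    \<comment> \<open>\<open>h\<close> is both the rounding parameter and the number of steps. The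
      4|P| in it cancels \<open>\<delta>\<close> and the 2 gives the factor 4, so the two error
      terms add up to 3/4 of the allowed error.\<close>
    have "\<delta> * 2 ^ h = 4 * 2 ^ j"
      by (simp add: \<delta>_def assms(6) power_add)
    then have "1 / (\<delta> * 2 ^ h) + 2 / (\<delta> * 2 ^ h) \<le> 1 / 2 ^ j"
      by (simp add: field_simps)
    then have "\<bar>(q - X h) $ i\<bar> \<le> 1 / 2 ^ j" for i
    proof -
      have "(q - X h) $ i \<le> (1 / (\<delta> * 2 ^ h) + 2 / (\<delta> * 2 ^ h)) * v $ i"
        using X[of h] by (simp only: less_eq_vec_def vector_scaleR_component real_scaleR_def)
      also have "\<dots> \<le> 1 / 2 ^ j * 1"
        using \<open>_ \<le> 1 / 2 ^ j\<close> v_pos[of i] v_less_1[of i] by (intro mult_mono) auto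
      finally show ?thesis using bounds(2)[of h] by (simp add: less_eq_vec_def)
    qed
    then have "infnorm (q - X h) \<le> 1 / 2 ^ j"
      by (auto simp: infnorm_cart intro!: cSup_least)
    then show ?thesis by (simp add: X_def assms(6))
  qed
  ultimately show ?thesis by blast
qed

end
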